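(* For every graph $H$ and every $k\in\mathbb{N}$, there exist $\varepsilon,s,K>0$ such that for every graph $G$ with $n>K$ vertices, and every $c$ with $0\le c\le 1$, if $G$ is not $(\varepsilon c^s,H)$-saturated, then there are pairwise disjoint subsets $A_1,\dots,A_k\subseteq V(G)$ such that either: (i) $(A_i,A_j)$ is a $c$-sparse $(\varepsilon c^s n,\varepsilon c^s n)$-pair for all distinct $i,j\in\{1,\dots,k\}$; or (ii) $(A_i,A_j)$ is a $(1-c)$-dense $(\varepsilon c^s n,\varepsilon c^s n)$-pair for all distinct $i,j\in\{1,\dots,k\}$.
   Context: All graphs are finite with no loops or parallel edges; $|G|$ is the number of vertices of $G$; $\mathbb{N}$ is the set of non-negative integers. A copy of $H$ in $G$ is an isomorphism between $H$ and an induced subgraph of $G$ (so copies are counted as labelled maps). For $\alpha\ge0$, $G$ is $(\alpha,H)$-saturated if there are at least $\alpha|G|^{|H|}$ copies of $H$ in $G$. A pair $(A,B)$ of subsets of $V(G)$ is an $(x,y)$-pair if $A\cap B=\emptyset$, $|A|\ge x$ and $|B|\ge y$. With $E(A,B)$ the set of edges between $A$ and $B$, a pair $(A,B)$ is $c$-sparse if $A\cap B=\emptyset$ and $|E(A,B)|\le c|A|\cdot|B|$, and $c$-dense if $A\cap B=\emptyset$ and $|E(A,B)|\ge c|A|\cdot|B|$. *)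

theory Defs
  imports Complex_Main "HOL-Library.FuncSet" "HOL-Library.Disjoint_Sets"
begin

record 'a graph =
  verts :: "'a set"
  edges :: "'a set set"

definition fin_simple_graph :: "'a graph \<Rightarrow> bool" where
  "fin_simple_graph G \<longleftrightarrow>
     finite (verts G) \<and> edges G \<subseteq> {e. e \<subseteq> verts G \<and> card e = 2}"

definition induced_subgraph :: "'a graph \<Rightarrow> 'a set \<Rightarrow> 'a graph" where
  "induced_subgraph G W = \<lparr>verts = W, edges = {e \<in> edges G. e \<subseteq> W}\<rparr>"

definition graph_iso :: "('a \<Rightarrow> 'b) \<Rightarrow> 'a graph \<Rightarrow> 'b graph \<Rightarrow> bool" where
  "graph_iso f H G \<longleftrightarrow>
     bij_betw f (verts H) (verts G) \<and>
     (\<forall>u\<in>verts H. \<forall>v\<in>verts H. {u, v} \<in> edges H \<longleftrightarrow> {f u, f v} \<in> edges G)"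

(* Maps are taken extensional on V(H), so that isomorphisms that agree on V(H)
   are counted once. *)
definition copies :: "'a graph \<Rightarrow> 'b graph \<Rightarrow> ('a \<Rightarrow> 'b) set" where
  "copies H G =
     {f \<in> extensional (verts H). \<exists>W \<subseteq> verts G. graph_iso f H (induced_subgraph G W)}"

definition saturated :: "real \<Rightarrow> 'a graph \<Rightarrow> 'b graph \<Rightarrow> bool" where
  "saturated \<alpha> H G \<longleftrightarrow>
     real (card (copies H G)) \<ge> \<alpha> * real (card (verts G)) ^ card (verts H)"

definition xy_pair :: "'a graph \<Rightarrow> real \<Rightarrow> real \<Rightarrow> 'a set \<Rightarrow> 'a set \<Rightarrow> bool" where
  "xy_pair G x y A B \<longleftrightarrow>
     A \<subseteq> verts G \<and> B \<subseteq> verts G \<and> A \<inter> B = {} \<and> real (card A) \<ge> x \<and> real (card B) \<ge> y"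

definition edges_between :: "'a graph \<Rightarrow> 'a set \<Rightarrow> 'a set \<Rightarrow> 'a set set" where
  "edges_between G A B = {e \<in> edges G. \<exists>a\<in>A. \<exists>b\<in>B. e = {a, b}}"

definition sparse_pair :: "'a graph \<Rightarrow> real \<Rightarrow> 'a set \<Rightarrow> 'a set \<Rightarrow> bool" where
  "sparse_pair G c A B \<longleftrightarrow>
     A \<inter> B = {} \<and> real (card (edges_between G A B)) \<le> c * real (card A) * real (card B)"

definition dense_pair :: "'a graph \<Rightarrow> real \<Rightarrow> 'a set \<Rightarrow> 'a set \<Rightarrow> bool" where
  "dense_pair G c A B \<longleftrightarrow>
     A \<inter> B = {} \<and> real (card (edges_between G A B)) \<ge> c * real (card A) * real (card B)"

end

theory Submission
  imports Defs "HOL-Library.Ramsey"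
begin

text \<open>
  Call a pair of sets thin if it is \<open>c\<close>-sparse or its complementary bipartite graph is, and
  write \<open>poly(c)\<close> for a quantity \<open>a c\<^sup>p\<close> with constants depending only on \<open>H\<close> and \<open>k\<close>.

  For two sets the theorem is a greedy embedding. Give each vertex \<open>x\<close> of \<open>H\<close> a
  set \<open>V\<^sub>x\<close> of vertices of \<open>G\<close> and choose the images one at a time. Either a positive proportion of
  \<open>V\<^sub>x\<close> has, towards every other \<open>V\<^sub>y\<close>, at least \<open>c |V\<^sub>y|\<close> (non-)neighbours of the kind that \<open>H\<close>
  prescribes, and the embedding continues inside these neighbourhoods; or the vertices of \<open>V\<^sub>x\<close>
  that fail for some \<open>y\<close> form with \<open>V\<^sub>y\<close> a thin pair. Hence either \<open>H\<close> has many copies or two of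
  the \<open>V\<^sub>x\<close> contain a thin pair of subsets of proportion \<open>poly(c)\<close>
  (\<open>many_transversal_maps_or_thin_pair\<close>).

  For \<open>k\<close> sets, split the vertex set of \<open>G\<close> into \<open>N\<close> blocks of equal size, where \<open>N\<close> is a Ramsey
  number that depends only on \<open>|H|\<close> and \<open>k\<close>. If there are \<open>|H|\<close> blocks no two of which are thin,
  shrink two of them by the two-set result so that they become thin. Thinness of the other
  pairs survives, because density grows by at most a \<open>1/poly(c)\<close> factor when a set shrinks to
  proportion \<open>poly(c)\<close>, and the initial threshold may be chosen a high power of \<open>c\<close>. Each round
  lowers the number of pairs that are not thin, so after boundedly many rounds any \<open>|H|\<close> blocks
  contain a thin pair; this is the induction in \<open>thin_blocks_if_few_copies\<close>. Ramsey's theorem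
  then gives many blocks that are pairwise thin, and among these \<open>k\<close> that are all sparse to each
  other or all dense to each other (\<open>ramsey_thin\<close>).
\<close>

section \<open>Monomial bounds\<close>

text \<open>The bounds are composed and multiplied repeatedly; closure of this class under these
  operations keeps every bound of the form \<open>a c\<^sup>p\<close> without computing its constants. With
  \<open>a \<le> 1\<close> the unit interval is mapped into itself, so a bound can serve as the next threshold.\<close>

definition monomials :: "(real \<Rightarrow> real) set" where
  "monomials = {\<lambda>c. a * c ^ p | a p. 0 < a \<and> a \<le> 1}"

lemma monomialsI: "0 < a \<Longrightarrow> a \<le> 1 \<Longrightarrow> (\<lambda>c. a * c ^ p) \<in> monomials"
  unfolding monomials_def by blast

lemma monomial_const: "0 < a \<Longrightarrow> a \<le> 1 \<Longrightarrow> (\<lambda>c. a) \<in> monomials"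
  using monomialsI[of a 0] by simp

lemma monomial_ident: "(\<lambda>c. c) \<in> monomials"
  using monomialsI[of 1 1] by simp

lemma monomial_pos: "f \<in> monomials \<Longrightarrow> 0 < c \<Longrightarrow> 0 < f c"
  unfolding monomials_def by auto

lemma monomial_le_1: "f \<in> monomials \<Longrightarrow> 0 < c \<Longrightarrow> c \<le> 1 \<Longrightarrow> f c \<le> 1"
  unfolding monomials_def by (auto intro!: mult_le_one power_le_one)

lemma monomial_mult:
  assumes "f \<in> monomials" "g \<in> monomials" shows "(\<lambda>c. f c * g c) \<in> monomials"
proof -
  obtain a p b r where "f = (\<lambda>c. a * c ^ p)" "0 < a" "a \<le> 1"
    "g = (\<lambda>c. b * c ^ r)" "0 < b" "b \<le> 1"
    using assms unfolding monomials_def by blast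
  then have "(\<lambda>c. f c * g c) = (\<lambda>c. (a * b) * c ^ (p + r))" "0 < a * b" "a * b \<le> 1"
    by (auto simp: power_add mult_le_one)
  then show ?thesis using monomialsI by metis
qed

lemma monomial_power: "f \<in> monomials \<Longrightarrow> (\<lambda>c. f c ^ n) \<in> monomials"
  by (induction n) (auto intro: monomial_mult monomial_const)

lemma monomial_comp:
  assumes "f \<in> monomials" "g \<in> monomials" shows "(\<lambda>c. f (g c)) \<in> monomials"
proof -
  obtain a p where f: "f = (\<lambda>c. a * c ^ p)" "0 < a" "a \<le> 1"
    using assms(1) unfolding monomials_def by blast
  show ?thesis unfolding f(1)
    by (intro monomial_mult monomial_const monomial_power f assms)
qed

section \<open>Thin pairs\<close>

text \<open>The flag \<open>q\<close> selects edges or non-edges: \<open>True\<close> means \<open>c\<close>-sparse and \<open>False\<close> means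
  \<open>(1 - c)\<close>-dense, so that both alternatives are handled by one argument. Ordered pairs are
  counted, which makes non-edges as easy to count as edges.\<close>

definition thin :: "'b graph \<Rightarrow> bool \<Rightarrow> real \<Rightarrow> 'b set \<Rightarrow> 'b set \<Rightarrow> bool" where
  "thin G q c A B \<longleftrightarrow>
     real (card {(a, b) \<in> A \<times> B. ({a, b} \<in> edges G) = q}) \<le> c * real (card A) * real (card B)"

lemma thin_sym: "thin G q c A B \<longleftrightarrow> thin G q c B A"
proof -
  have "bij_betw prod.swap {(a, b) \<in> A \<times> B. ({a, b} \<in> edges G) = q}
      {(a, b) \<in> B \<times> A. ({a, b} \<in> edges G) = q}"
    by (rule bij_betw_byWitness[where f' = prod.swap]) (auto simp: insert_commute)
  then show ?thesis
    unfolding thin_def by (simp add: bij_betw_same_card mult.commute mult.left_commute)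
qed

lemma thin_mono: "thin G q c A B \<Longrightarrow> c \<le> d \<Longrightarrow> thin G q d A B"
  unfolding thin_def by (erule order_trans) (intro mult_right_mono; simp)

text \<open>Passing to a subset of proportion at least \<open>t\<close> keeps the count but may shrink the
  number of available pairs by the factor \<open>t\<close>; the threshold must therefore start smaller by the factor \<open>t\<close>.\<close>

lemma thin_subset:
  assumes thin: "thin G q (t * c) A B" and "A' \<subseteq> A" "finite A" "finite B"
    and A': "t * real (card A) \<le> real (card A')" and c: "0 \<le> c"
  shows "thin G q c A' B"
proof -
  have "real (card {(a, b) \<in> A' \<times> B. ({a, b} \<in> edges G) = q})
      \<le> real (card {(a, b) \<in> A \<times> B. ({a, b} \<in> edges G) = q})"
    using assms(2-4) by (intro of_nat_mono card_mono) (auto intro: finite_subset[of _ "A \<times> B"])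
  also have "\<dots> \<le> t * c * real (card A) * real (card B)"
    using thin unfolding thin_def .
  also have "\<dots> = (t * real (card A)) * (c * real (card B))" by simp
  also have "\<dots> \<le> real (card A') * (c * real (card B))"
    using A' c by (intro mult_right_mono) auto
  finally show ?thesis unfolding thin_def by (simp add: mult_ac)
qed

lemma thin_if_degrees:
  assumes "finite A" "finite B"
    and deg: "\<And>a. a \<in> A \<Longrightarrow> real (card {b \<in> B. ({a, b} \<in> edges G) = q}) \<le> c * real (card B)"
  shows "thin G q c A B"
proof -
  have "{(a, b) \<in> A \<times> B. ({a, b} \<in> edges G) = q} = Sigma A (\<lambda>a. {b \<in> B. ({a, b} \<in> edges G) = q})"
    by auto
  then have "real (card {(a, b) \<in> A \<times> B. ({a, b} \<in> edges G) = q})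
      = (\<Sum>a\<in>A. real (card {b \<in> B. ({a, b} \<in> edges G) = q}))"
    using assms(1,2) by (simp add: card_SigmaI)
  also have "\<dots> \<le> (\<Sum>a\<in>A. c * real (card B))" by (intro sum_mono deg)
  finally show ?thesis unfolding thin_def by (simp add: mult_ac)
qed

lemma card_edges_between:
  assumes "A \<inter> B = {}"
  shows "card (edges_between G A B) = card {(a, b) \<in> A \<times> B. {a, b} \<in> edges G}"
proof -
  have "edges_between G A B = (\<lambda>(a, b). {a, b}) ` {(a, b) \<in> A \<times> B. {a, b} \<in> edges G}"
    unfolding edges_between_def by auto
  moreover have "inj_on (\<lambda>(a, b). {a, b}) {(a, b) \<in> A \<times> B. {a, b} \<in> edges G}"
    using assms by (auto simp: inj_on_def doubleton_eq_iff)
  ultimately show ?thesis by (simp add: card_image)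
qed

lemma thin_True_sparse: "A \<inter> B = {} \<Longrightarrow> thin G True c A B \<Longrightarrow> sparse_pair G c A B"
  unfolding sparse_pair_def thin_def by (simp add: card_edges_between)

lemma thin_False_dense:
  assumes "A \<inter> B = {}" "finite A" "finite B" "thin G False c A B"
  shows "dense_pair G (1 - c) A B"
proof -
  let ?E = "{(a, b) \<in> A \<times> B. {a, b} \<in> edges G}"
  let ?F = "{(a, b) \<in> A \<times> B. {a, b} \<notin> edges G}"
  have "?E \<subseteq> A \<times> B" "?F \<subseteq> A \<times> B" by auto
  then have "finite ?E" "finite ?F" using finite_subset[OF _ finite_cartesian_product[OF assms(2,3)]] by blast+
  moreover have "?E \<inter> ?F = {}" by auto
  ultimately have "card ?E + card ?F = card (?E \<union> ?F)" by (rule card_Un_disjoint[symmetric])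
  also have "?E \<union> ?F = A \<times> B" by auto
  finally have "card ?E + card ?F = card A * card B" by (simp add: card_cartesian_product)
  then have "real (card ?E) + real (card ?F) = real (card A) * real (card B)"
    by (simp flip: of_nat_add of_nat_mult)
  with assms show ?thesis
    unfolding dense_pair_def thin_def by (simp add: card_edges_between algebra_simps)
qed

section \<open>Transversal copies\<close>

definition transversal_maps ::
    "'a graph \<Rightarrow> 'b graph \<Rightarrow> 'a set \<Rightarrow> ('a \<Rightarrow> 'b set) \<Rightarrow> ('a \<Rightarrow> 'b) set" where
  "transversal_maps H G S V = {f \<in> PiE S V.
     \<forall>u\<in>S. \<forall>v\<in>S. u \<noteq> v \<longrightarrow> ({f u, f v} \<in> edges G) = ({u, v} \<in> edges H)}"

lemma finite_transversal_maps:
  "finite S \<Longrightarrow> (\<And>x. x \<in> S \<Longrightarrow> finite (V x)) \<Longrightarrow> finite (transversal_maps H G S V)"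
  unfolding transversal_maps_def by (auto intro: finite_subset[OF _ finite_PiE])

text \<open>Once \<open>x\<close> is sent to \<open>v\<close>, the images of the other vertices are confined to the
  neighbourhoods or non-neighbourhoods of \<open>v\<close>. Different choices of \<open>v\<close>, or of the rest, give
  different maps, so the counts add up.\<close>

lemma transversal_maps_extend:
  fixes H :: "'a graph" and G :: "'b graph"
  assumes "finite S" "x \<notin> S" "\<And>y. y \<in> insert x S \<Longrightarrow> finite (V y)" "\<Gamma> \<subseteq> V x"
  shows "(\<Sum>v\<in>\<Gamma>. card (transversal_maps H G S
             (\<lambda>y. {w \<in> V y. ({v, w} \<in> edges G) = ({x, y} \<in> edges H)})))
         \<le> card (transversal_maps H G (insert x S) V)"
proof -
  define T where "T v = transversal_maps H G S
    (\<lambda>y. {w \<in> V y. ({v, w} \<in> edges G) = ({x, y} \<in> edges H)})" for v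
  have fin: "finite (T v)" for v
    unfolding T_def using assms(1,3) by (intro finite_transversal_maps) auto
  have "finite \<Gamma>" using assms(3,4) finite_subset by blast
  then have "(\<Sum>v\<in>\<Gamma>. card (T v)) = card (Sigma \<Gamma> T)"
    using fin by (simp add: card_SigmaI)
  also have "\<dots> = card ((\<lambda>(v, g). g(x := v)) ` Sigma \<Gamma> T)"
  proof (rule card_image[symmetric], rule inj_onI, clarify)
    fix v g v' g'
    assume g: "g \<in> T v" "g' \<in> T v'" and eq: "g(x := v) = g'(x := v')"
    have ext: "g x = undefined" "g' x = undefined"
      using g assms(2) unfolding T_def transversal_maps_def PiE_def extensional_def by auto
    show "v = v' \<and> g = g'"
    proof
      show "v = v'" using fun_cong[OF eq, of x] by simp
      show "g = g'"
      proof
        fix y show "g y = g' y" using fun_cong[OF eq, of y] ext by (cases "y = x") auto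
      qed
    qed
  qed
  also have "\<dots> \<le> card (transversal_maps H G (insert x S) V)"
  proof (rule card_mono)
    show "finite (transversal_maps H G (insert x S) V)"
      using assms(1,3) by (intro finite_transversal_maps) auto
    show "(\<lambda>(v, g). g(x := v)) ` Sigma \<Gamma> T \<subseteq> transversal_maps H G (insert x S) V"
    proof clarify
      fix v g assume v: "v \<in> \<Gamma>" and g: "g \<in> T v"
      have "g \<in> PiE S V"
        using g unfolding T_def transversal_maps_def by (auto simp: PiE_iff)
      then have "g(x := v) \<in> PiE (insert x S) V"
        using v assms(4) by (intro PiE_fun_upd) auto
      moreover have new: "({v, g y} \<in> edges G) = ({x, y} \<in> edges H)" if "y \<in> S" for y
        using g that unfolding T_def transversal_maps_def by (auto simp: PiE_iff)
      moreover have "({g y, v} \<in> edges G) = ({y, x} \<in> edges H)" if "y \<in> S" for y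
        using new[OF that] by (simp add: insert_commute)
      moreover have "({g u, g w} \<in> edges G) = ({u, w} \<in> edges H)"
        if "u \<in> S" "w \<in> S" "u \<noteq> w" for u w
        using g that unfolding T_def transversal_maps_def by auto
      ultimately show "g(x := v) \<in> transversal_maps H G (insert x S) V"
        using assms(2) unfolding transversal_maps_def by auto
    qed
  qed
  finally show ?thesis unfolding T_def .
qed

lemma transversal_maps_subset_copies:
  assumes H: "fin_simple_graph H" and G: "fin_simple_graph G"
    and V: "\<And>x. x \<in> verts H \<Longrightarrow> V x \<subseteq> verts G" and disj: "disjoint_family_on V (verts H)"
  shows "transversal_maps H G (verts H) V \<subseteq> copies H G"
proof
  fix f assume f: "f \<in> transversal_maps H G (verts H) V"
  then have fP: "f \<in> PiE (verts H) V"
    and adj: "\<And>u v. u \<in> verts H \<Longrightarrow> v \<in> verts H \<Longrightarrow> u \<noteq> v \<Longrightarrow>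
                ({f u, f v} \<in> edges G) = ({u, v} \<in> edges H)"
    unfolding transversal_maps_def by auto
  have "inj_on f (verts H)"
    using fP disj unfolding disjoint_family_on_def inj_on_def by (fastforce simp: PiE_iff)
  moreover have "{w} \<notin> edges G" for w
    using G unfolding fin_simple_graph_def by auto
  moreover have "{w} \<notin> edges H" for w
    using H unfolding fin_simple_graph_def by auto
  ultimately have "graph_iso f H (induced_subgraph G (f ` verts H))"
    unfolding graph_iso_def induced_subgraph_def bij_betw_def
    by (auto simp: adj) (metis adj insert_absorb2)+
  moreover have "f ` verts H \<subseteq> verts G" "f \<in> extensional (verts H)"
    using fP V by (fastforce simp: PiE_iff)+
  ultimately show "f \<in> copies H G" unfolding copies_def by blast
qed

lemma finite_copies:
  assumes "fin_simple_graph H" "fin_simple_graph G"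
  shows "finite (copies H G)"
proof (rule finite_subset)
  show "copies H G \<subseteq> PiE (verts H) (\<lambda>_. verts G)"
  proof
    fix f assume "f \<in> copies H G"
    then have "f \<in> extensional (verts H)" "f ` verts H \<subseteq> verts G"
      unfolding copies_def graph_iso_def induced_subgraph_def bij_betw_def by auto
    then show "f \<in> PiE (verts H) (\<lambda>_. verts G)" unfolding PiE_iff by blast
  qed
  show "finite (PiE (verts H) (\<lambda>_. verts G))"
    using assms unfolding fin_simple_graph_def by (intro finite_PiE) auto
qed

section \<open>Greedy embedding\<close>

text \<open>The sizes are measured relative to \<open>X\<close> and \<open>Y\<close>, since \<open>thin_subset\<close> needs proportions:
  an absolute lower bound says nothing when the blocks have different sizes.\<close>

definition has_thin_pair :: "'b graph \<Rightarrow> real \<Rightarrow> real \<Rightarrow> 'b set \<Rightarrow> 'b set \<Rightarrow> bool" where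
  "has_thin_pair G c t X Y \<longleftrightarrow> (\<exists>A\<subseteq>X. \<exists>B\<subseteq>Y.
     t * real (card X) \<le> real (card A) \<and> t * real (card Y) \<le> real (card B) \<and> (\<exists>q. thin G q c A B))"

lemma has_thin_pair_superset:
  assumes "has_thin_pair G c t X Y" "X \<subseteq> X'" "Y \<subseteq> Y'" "0 \<le> t"
    "r * real (card X') \<le> real (card X)" "r * real (card Y') \<le> real (card Y)" "t' \<le> t * r"
  shows "has_thin_pair G c t' X' Y'"
proof -
  have le: "t' * real (card Z') \<le> z"
    if "r * real (card Z') \<le> real (card Z)" "t * real (card Z) \<le> z" for Z Z' :: "'a set" and z
  proof -
    have "t' * real (card Z') \<le> t * r * real (card Z')" using assms(7) by (intro mult_right_mono) auto
    also have "\<dots> = t * (r * real (card Z'))" by simp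
    also have "\<dots> \<le> t * real (card Z)" using that(1) assms(4) by (rule mult_left_mono)
    finally show ?thesis using that(2) by simp
  qed
  obtain A B q where AB: "A \<subseteq> X" "B \<subseteq> Y" "thin G q c A B"
      "t * real (card X) \<le> real (card A)" "t * real (card Y) \<le> real (card B)"
    using assms(1) unfolding has_thin_pair_def by blast
  have "A \<subseteq> X'" "B \<subseteq> Y'" using AB assms(2,3) by auto
  then show ?thesis
    using AB(3) le[OF assms(5) AB(4)] le[OF assms(6) AB(5)] unfolding has_thin_pair_def by blast
qed

text \<open>Induction over the vertices of \<open>H\<close>. A new vertex \<open>x\<close> is embedded first. If at most half of
  \<open>V x\<close> is bad, each good \<open>v\<close> leaves sets of proportion \<open>c\<close> in the other \<open>V y\<close>, to which the
  induction hypothesis applies: it yields either many extensions of every good \<open>v\<close> or a thin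
  pair, whose proportion drops only by the factor \<open>c\<close>.\<close>

lemma many_transversal_maps_or_thin_pair:
  fixes H :: "'a graph"
  assumes "finite S"
  shows "\<exists>f\<in>monomials. \<forall>(G::'b graph) V c. 0 < c \<and> c \<le> 1 \<and> (\<forall>x\<in>S. finite (V x)) \<longrightarrow>
    f c * (\<Prod>x\<in>S. real (card (V x))) \<le> real (card (transversal_maps H G S V)) \<or>
    (\<exists>x\<in>S. \<exists>y\<in>S. x \<noteq> y \<and> has_thin_pair G c (f c) (V x) (V y))"
  using assms
proof (induction S rule: finite_induct)
  case empty
  have "transversal_maps H G {} V = {\<lambda>_. undefined}" for G :: "'b graph" and V
    unfolding transversal_maps_def by auto
  then show ?case using monomial_const[of 1] by (intro bexI[of _ "\<lambda>_. 1"]) auto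
next
  case (insert x S)
  from insert.IH obtain f where f: "f \<in> monomials" and IH: "\<forall>(G::'b graph) V c.
    0 < c \<and> c \<le> 1 \<and> (\<forall>x\<in>S. finite (V x)) \<longrightarrow>
    f c * (\<Prod>x\<in>S. real (card (V x))) \<le> real (card (transversal_maps H G S V)) \<or>
    (\<exists>x\<in>S. \<exists>y\<in>S. x \<noteq> y \<and> has_thin_pair G c (f c) (V x) (V y))" ..
  define n where "n = card S"
  \<comment> \<open>Bad sets of proportion at most \<open>d\<close> for each of the \<open>n\<close> other vertices cover less than half.\<close>
  define d where "d = 1 / (2 * (real n + 1))"
  have d: "0 < d" "d \<le> 1 / 2" unfolding d_def by (auto simp: field_simps)
  define f' where "f' = (\<lambda>c. d * c ^ (n + 1) * f c)"
  have f': "f' \<in> monomials"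
    unfolding f'_def using d by (intro monomial_mult f monomialsI) auto
  show ?case
  proof (rule bexI[OF _ f'], intro allI impI, elim conjE)
    fix G :: "'b graph" and V :: "'a \<Rightarrow> 'b set" and c :: real
    assume c: "0 < c" "c \<le> 1" and V: "\<forall>y\<in>insert x S. finite (V y)"
    have fc: "0 < f c" "f c \<le> 1" using f c monomial_pos monomial_le_1 by auto
    have cn: "c ^ n \<le> 1" "c ^ (n + 1) \<le> 1" "0 < c ^ n"
      using c power_le_one[of c n] power_le_one[of c "n + 1"] by auto
    have f'd: "f' c \<le> d"
    proof -
      have "c ^ (n + 1) * f c \<le> 1" using cn fc c by (intro mult_le_one) auto
      then show ?thesis using d unfolding f'_def by (simp add: mult.assoc mult_left_le)
    qed
    have f'c: "f' c \<le> f c * c"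
    proof -
      have "d * c ^ n \<le> 1" using cn d by (intro mult_le_one) auto
      then have "(d * c ^ n) * (c * f c) \<le> 1 * (c * f c)"
        using c fc by (intro mult_right_mono) auto
      then show ?thesis unfolding f'_def by (simp add: mult_ac)
    qed
    have f'2: "f' c \<le> c ^ n * f c / 2"
    proof -
      have "d * c \<le> 1/2 * 1" using d c by (intro mult_mono) auto
      then have "(d * c) * (c ^ n * f c) \<le> (1/2 * 1) * (c ^ n * f c)"
        using cn fc by (intro mult_right_mono) auto
      then show ?thesis unfolding f'_def by (simp add: mult_ac)
    qed
    let ?pair = "\<exists>u\<in>insert x S. \<exists>y\<in>insert x S. u \<noteq> y \<and> has_thin_pair G c (f' c) (V u) (V y)"
    show "f' c * (\<Prod>y\<in>insert x S. real (card (V y)))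
            \<le> real (card (transversal_maps H G (insert x S) V)) \<or> ?pair"
    proof (cases ?pair)
      case False
      \<comment> \<open>\<open>N v y\<close> is where \<open>y\<close> may still go after \<open>x\<close> has gone to \<open>v\<close>, and \<open>D y\<close> is the set of
          choices that leave too little room for \<open>y\<close>.\<close>
      define N where "N v y = {w \<in> V y. ({v, w} \<in> edges G) = ({x, y} \<in> edges H)}" for v y
      define D where "D y = {v \<in> V x. real (card (N v y)) < c * real (card (V y))}" for y
      have D: "real (card (D y)) \<le> d * real (card (V x))" if y: "y \<in> S" for y
      proof (rule ccontr)
        assume "\<not> real (card (D y)) \<le> d * real (card (V x))"
        moreover have "f' c * real (card (V x)) \<le> d * real (card (V x))"
          using f'd by (intro mult_right_mono) auto
        ultimately have 1: "f' c * real (card (V x)) \<le> real (card (D y))" by linarith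
        have 2: "f' c * real (card (V y)) \<le> real (card (V y))"
          using monomial_le_1[OF f' c] by (simp add: mult_left_le_one_le monomial_pos[OF f' c(1)] less_imp_le)
        have "thin G ({x, y} \<in> edges H) c (D y) (V y)"
        proof (rule thin_if_degrees)
          show "finite (D y)" using V unfolding D_def by auto
          show "finite (V y)" using V y by auto
          show "real (card {b \<in> V y. ({a, b} \<in> edges G) = ({x, y} \<in> edges H)}) \<le> c * real (card (V y))"
            if "a \<in> D y" for a using that unfolding D_def N_def by auto
        qed
        moreover have "D y \<subseteq> V x" unfolding D_def by auto
        moreover have "x \<noteq> y" using y insert.hyps by auto
        ultimately show False using 1 2 y False unfolding has_thin_pair_def by blast
      qed
      define \<Gamma> where "\<Gamma> = V x - (\<Union>y\<in>S. D y)"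
      have "real (card (\<Union>y\<in>S. D y)) \<le> (\<Sum>y\<in>S. real (card (D y)))"
        using card_UN_le[OF insert.hyps(1), of D] by (simp flip: of_nat_sum)
      also have "\<dots> \<le> (\<Sum>y\<in>S. d * real (card (V x)))" using D by (intro sum_mono) auto
      also have "\<dots> = real n * d * real (card (V x))" unfolding n_def by simp
      also have "\<dots> \<le> 1 / 2 * real (card (V x))"
        unfolding d_def by (intro mult_right_mono) (auto simp: field_simps)
      finally have bad: "real (card (\<Union>y\<in>S. D y)) \<le> real (card (V x)) / 2" by simp
      have "card (V x) - card (\<Union>y\<in>S. D y) \<le> card \<Gamma>"
        unfolding \<Gamma>_def using V insert.hyps(1)
        by (intro diff_card_le_card_Diff) (auto simp: D_def)
      then have \<Gamma>: "real (card (V x)) / 2 \<le> real (card \<Gamma>)" using bad by linarith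
      define P where "P = (\<Prod>y\<in>S. real (card (V y)))"
      have "0 \<le> P" unfolding P_def by (simp add: prod_nonneg)
      have step: "f c * (c ^ n * P) \<le> real (card (transversal_maps H G S (N v)))" if v: "v \<in> \<Gamma>" for v
      proof -
        have fin: "finite (N v y)" if "y \<in> S" for y using V that unfolding N_def by auto
        have N: "c * real (card (V y)) \<le> real (card (N v y))" if "y \<in> S" for y
          using v that unfolding \<Gamma>_def D_def by auto
        have "\<not> has_thin_pair G c (f c) (N v u) (N v y)" if "u \<in> S" "y \<in> S" "u \<noteq> y" for u y
        proof
          assume "has_thin_pair G c (f c) (N v u) (N v y)"
          then have "has_thin_pair G c (f' c) (V u) (V y)"
            by (rule has_thin_pair_superset[where r = c])
              (use fc f'c N that in \<open>auto simp: N_def\<close>)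
          then show False using False that by blast
        qed
        then have "f c * (\<Prod>y\<in>S. real (card (N v y))) \<le> real (card (transversal_maps H G S (N v)))"
          using IH[rule_format, of c "N v" G] c fin by auto
        moreover have "c ^ n * P = (\<Prod>y\<in>S. c * real (card (V y)))"
          unfolding P_def n_def by (simp add: prod.distrib)
        moreover have "\<dots> \<le> (\<Prod>y\<in>S. real (card (N v y)))"
          using N c by (intro prod_mono) auto
        ultimately show ?thesis using fc by (smt (verit) mult_left_mono)
      qed
      have "f' c * (real (card (V x)) * P) \<le> c ^ n * f c / 2 * (real (card (V x)) * P)"
        using f'2 \<open>0 \<le> P\<close> by (intro mult_right_mono) auto
      also have "\<dots> = real (card (V x)) / 2 * (f c * (c ^ n * P))" by simp
      also have "\<dots> \<le> real (card \<Gamma>) * (f c * (c ^ n * P))"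
        using \<Gamma> fc c \<open>0 \<le> P\<close> by (intro mult_right_mono) auto
      also have "\<dots> \<le> (\<Sum>v\<in>\<Gamma>. real (card (transversal_maps H G S (N v))))"
        using sum_mono[of \<Gamma> "\<lambda>_. f c * (c ^ n * P)", OF step] by simp
      also have "\<dots> \<le> real (card (transversal_maps H G (insert x S) V))"
      proof -
        have "(\<Sum>v\<in>\<Gamma>. card (transversal_maps H G S (N v))) \<le> card (transversal_maps H G (insert x S) V)"
          unfolding N_def using V insert.hyps by (intro transversal_maps_extend) (auto simp: \<Gamma>_def)
        then show ?thesis by (simp flip: of_nat_sum)
      qed
      finally show ?thesis using insert.hyps unfolding P_def by simp
    qed simp
  qed
qed

section \<open>Making many blocks pairwise thin\<close>

text \<open>Two applications of Ramsey's theorem for graphs: the first separates thin pairs from the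
  others and gives a large clique of thin pairs unless some \<open>h\<close> blocks are pairwise not thin; the
  second, inside that clique, separates sparse from dense.\<close>

lemma ramsey_thin:
  "\<exists>N\<ge>1. \<forall>(G::'b graph) c V.
    (\<exists>R\<subseteq>{..<N::nat}. card R = h \<and> (\<forall>i\<in>R. \<forall>j\<in>R. i \<noteq> j \<longrightarrow> \<not> (\<exists>q. thin G q c (V i) (V j)))) \<or>
    (\<exists>R\<subseteq>{..<N}. card R = k \<and> (\<exists>q. \<forall>i\<in>R. \<forall>j\<in>R. i \<noteq> j \<longrightarrow> thin G q c (V i) (V j)))"
proof -
  obtain r where r: "\<And>(W :: nat set) E. finite W \<Longrightarrow> card W \<ge> r \<Longrightarrow>
      \<exists>R\<subseteq>W. card R = k \<and> clique R E \<or> card R = k \<and> indep R E"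
    using ramsey2[of k k] by metis
  obtain N where N: "N \<ge> 1" "\<And>(W :: nat set) E. finite W \<Longrightarrow> card W \<ge> N \<Longrightarrow>
      \<exists>R\<subseteq>W. card R = r \<and> clique R E \<or> card R = h \<and> indep R E"
    using ramsey2[of r h] by metis
  show ?thesis
  proof (intro exI[of _ N] conjI N(1) allI)
    fix G :: "'b graph" and c and V :: "nat \<Rightarrow> 'b set"
    define T where "T q = {{i, j} | i j. thin G q c (V i) (V j)}" for q
    have T: "{i, j} \<in> T q \<longleftrightarrow> thin G q c (V i) (V j)" for q and i j :: nat
      unfolding T_def using thin_sym[of G q c] by (auto simp: doubleton_eq_iff)
    obtain R where R: "R \<subseteq> {..<N}" "card R = r \<and> clique R (T True \<union> T False) \<or> card R = h \<and> indep R (T True \<union> T False)"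
      using N(2)[of "{..<N}" "T True \<union> T False"] by auto
    show "(\<exists>R\<subseteq>{..<N}. card R = h \<and> (\<forall>i\<in>R. \<forall>j\<in>R. i \<noteq> j \<longrightarrow> \<not> (\<exists>q. thin G q c (V i) (V j)))) \<or>
      (\<exists>R\<subseteq>{..<N}. card R = k \<and> (\<exists>q. \<forall>i\<in>R. \<forall>j\<in>R. i \<noteq> j \<longrightarrow> thin G q c (V i) (V j)))"
      using R(2)
    proof (elim disjE conjE)
      assume "card R = h" "indep R (T True \<union> T False)"
      then have "\<forall>i\<in>R. \<forall>j\<in>R. i \<noteq> j \<longrightarrow> \<not> (\<exists>q. thin G q c (V i) (V j))"
        unfolding indep_def Un_iff T ex_bool_eq by blast
      then show ?thesis using R(1) \<open>card R = h\<close> by blast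
    next
      assume "card R = r" and cl: "clique R (T True \<union> T False)"
      then obtain Q where Q: "Q \<subseteq> R" "card Q = k" "clique Q (T True) \<or> indep Q (T True)"
        using r[of R "T True"] finite_subset[OF R(1)] by auto
      have "clique Q (T True \<union> T False)" using cl Q(1) by (rule smaller_clique)
      then have "clique Q (T True) \<or> clique Q (T False)"
        using Q(3) unfolding indep_def clique_def by blast
      then have "\<exists>q. \<forall>i\<in>Q. \<forall>j\<in>Q. i \<noteq> j \<longrightarrow> thin G q c (V i) (V j)"
        unfolding clique_def T by blast
      moreover have "Q \<subseteq> {..<N}" using Q(1) R(1) by (rule order_trans)
      ultimately show ?thesis using Q(2) by blast
    qed
  qed
qed

definition undecided :: "'b graph \<Rightarrow> nat \<Rightarrow> real \<Rightarrow> (nat \<Rightarrow> 'b set) \<Rightarrow> nat set set" where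
  "undecided G N c V = {{i, j} | i j. i < N \<and> j < N \<and> i \<noteq> j \<and> \<not> (\<exists>q. thin G q c (V i) (V j))}"

lemma undecided_iff:
  "{i, j} \<in> undecided G N c V \<longleftrightarrow> i < N \<and> j < N \<and> i \<noteq> j \<and> \<not> (\<exists>q. thin G q c (V i) (V j))"
  unfolding undecided_def using thin_sym[of G _ c] by (auto simp: doubleton_eq_iff)

lemma undecided_subset_Pow: "undecided G N c V \<subseteq> Pow {..<N}"
  unfolding undecided_def by auto

text \<open>The induction on \<open>m\<close> counts the rounds of shrinking that may still be needed. The threshold for
  the undecided pairs is the bound \<open>f c\<close> itself, and it gets smaller with \<open>m\<close>: whatever is thin
  before a round must still be thin, at the next threshold, after it. The case \<open>m = 0\<close> is
  vacuous.\<close>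

lemma thin_blocks_if_few_copies:
  fixes H :: "'a graph"
  assumes H: "fin_simple_graph H"
    and ramsey: "\<And>(G::'b graph) c V.
    (\<exists>R\<subseteq>{..<N}. card R = card (verts H) \<and>
        (\<forall>i\<in>R. \<forall>j\<in>R. i \<noteq> j \<longrightarrow> \<not> (\<exists>q. thin G q c (V i) (V j)))) \<or>
    (\<exists>R\<subseteq>{..<N}. card R = k \<and> (\<exists>q. \<forall>i\<in>R. \<forall>j\<in>R. i \<noteq> j \<longrightarrow> thin G q c (V i) (V j)))"
  shows "\<exists>f\<in>monomials. \<forall>(G::'b graph) V c M. fin_simple_graph G \<and> 0 < c \<and> c \<le> 1 \<and> 0 < M \<and>
    (\<forall>i<N. V i \<subseteq> verts G \<and> M \<le> real (card (V i))) \<and> disjoint_family_on V {..<N} \<and>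
    real (card (copies H G)) < f c * M ^ card (verts H) \<and> card (undecided G N (f c) V) < m \<longrightarrow>
    (\<exists>W R q. R \<subseteq> {..<N} \<and> card R = k \<and> (\<forall>i\<in>R. W i \<subseteq> V i \<and> f c * M \<le> real (card (W i))) \<and>
       (\<forall>i\<in>R. \<forall>j\<in>R. i \<noteq> j \<longrightarrow> thin G q c (W i) (W j)))"
proof (induction m)
  case 0
  show ?case using monomial_ident by blast
next
  case (Suc m)
  let ?h = "card (verts H)"
  have finH: "finite (verts H)" using H unfolding fin_simple_graph_def by simp
  from Suc.IH obtain f where f: "f \<in> monomials" and IH: "\<forall>(G::'b graph) V c M.
    fin_simple_graph G \<and> 0 < c \<and> c \<le> 1 \<and> 0 < M \<and>
    (\<forall>i<N. V i \<subseteq> verts G \<and> M \<le> real (card (V i))) \<and> disjoint_family_on V {..<N} \<and>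
    real (card (copies H G)) < f c * M ^ card (verts H) \<and> card (undecided G N (f c) V) < m \<longrightarrow>
    (\<exists>W R q. R \<subseteq> {..<N} \<and> card R = k \<and> (\<forall>i\<in>R. W i \<subseteq> V i \<and> f c * M \<le> real (card (W i))) \<and>
       (\<forall>i\<in>R. \<forall>j\<in>R. i \<noteq> j \<longrightarrow> thin G q c (W i) (W j)))" ..
  from many_transversal_maps_or_thin_pair[OF finH, of H] obtain g where g: "g \<in> monomials" and
    embed: "\<forall>(G::'b graph) V c. 0 < c \<and> c \<le> 1 \<and> (\<forall>x\<in>verts H. finite (V x)) \<longrightarrow>
    g c * (\<Prod>x\<in>verts H. real (card (V x))) \<le> real (card (transversal_maps H G (verts H) V)) \<or>
    (\<exists>x\<in>verts H. \<exists>y\<in>verts H. x \<noteq> y \<and> has_thin_pair G c (g c) (V x) (V y))" ..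
  \<comment> \<open>The next round needs pairs that are thin at threshold \<open>f c\<close>, and the final answer pairs that
      are thin at \<open>c\<close>; \<open>c * f c\<close> meets both. The blocks then shrink by \<open>t = g (c * f c)\<close>: two factors
      \<open>t\<close> pay for the shrinking of both sides of a pair, and \<open>t ^ h\<close> for the number of copies
      relative to the smaller blocks.\<close>
  define f' where "f' = (\<lambda>c. c * f c * (g (c * f c)) ^ (?h + 2))"
  have f': "f' \<in> monomials"
    unfolding f'_def
    by (intro monomial_mult monomial_power monomial_comp[OF g] monomial_ident f)
  show ?case
  proof (rule bexI[OF _ f'], intro allI impI, elim conjE)
    fix G :: "'b graph" and V :: "nat \<Rightarrow> 'b set" and c M :: real
    assume G: "fin_simple_graph G" and c: "0 < c" "c \<le> 1" and M: "0 < M"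
      and V: "\<forall>i<N. V i \<subseteq> verts G \<and> M \<le> real (card (V i))"
      and disj: "disjoint_family_on V {..<N}"
      and few: "real (card (copies H G)) < f' c * M ^ ?h"
      and und: "card (undecided G N (f' c) V) < Suc m"
    define c1 where "c1 = c * f c"
    define t where "t = g c1"
    have fc: "0 < f c" "f c \<le> 1" using f c monomial_pos monomial_le_1 by auto
    have c1: "0 < c1" "c1 \<le> 1" "c1 \<le> c" "c1 \<le> f c"
      unfolding c1_def using c fc by (auto simp: mult_le_one mult_left_le mult_left_le_one_le)
    have t: "0 < t" "t \<le> 1" unfolding t_def using g c1 monomial_pos monomial_le_1 by auto
    have th: "0 < t ^ ?h" "t ^ ?h \<le> 1" using t by (auto intro: power_le_one)
    have f'_eq: "f' c = c1 * (t * (t * t ^ ?h))" unfolding f'_def c1_def t_def by (simp add: mult_ac)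
    have f'1: "f' c \<le> 1" using monomial_le_1[OF f' c] .
    have le: "a * b \<le> b" if "0 \<le> b" "a \<le> 1" for a b :: real
      using mult_right_mono[OF that(2,1)] by simp
    have b1: "c1 * (t * t ^ ?h) \<le> 1" "t * t \<le> 1" "t * (t * t ^ ?h) \<le> 1"
      using c1 t th by (auto intro!: mult_le_one)
    have f't: "f' c \<le> t"
      using le[of t "c1 * (t * t ^ ?h)"] b1(1) t unfolding f'_eq by (simp add: mult_ac)
    have f'c1: "f' c \<le> c1"
      using le[of c1 "t * (t * t ^ ?h)"] b1(3) c1 unfolding f'_eq by (simp add: mult_ac)
    have f'tt: "f' c \<le> t * (t * f c)"
    proof -
      have "c1 * t ^ ?h \<le> f c * 1" using c1 th by (intro mult_mono) auto
      then have "t * t * (c1 * t ^ ?h) \<le> t * t * f c" using t by (intro mult_left_mono) auto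
      then show ?thesis unfolding f'_eq by (simp add: mult_ac)
    qed
    have f'th: "f' c \<le> f c * t ^ ?h"
    proof -
      have "c1 * (t * t) \<le> f c * 1" using c1 b1 t by (intro mult_mono) auto
      then have "t ^ ?h * (c1 * (t * t)) \<le> t ^ ?h * f c" using th by (intro mult_left_mono) auto
      then show ?thesis unfolding f'_eq by (simp add: mult_ac)
    qed
    have f'ft: "f' c \<le> f c * t"
    proof -
      have "t * (t * f c) \<le> t * f c" using t fc by (intro le) auto
      then show ?thesis using f'tt by (simp add: mult.commute)
    qed
    have finV: "finite (V i)" if "i < N" for i
      using V G that finite_subset[of "V i" "verts G"] unfolding fin_simple_graph_def by simp
    show "\<exists>W R q. R \<subseteq> {..<N} \<and> card R = k \<and> (\<forall>i\<in>R. W i \<subseteq> V i \<and> f' c * M \<le> real (card (W i))) \<and>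
       (\<forall>i\<in>R. \<forall>j\<in>R. i \<noteq> j \<longrightarrow> thin G q c (W i) (W j))"
      using ramsey[of G c1 V]
    proof (elim disjE exE conjE)
      fix R q assume R: "R \<subseteq> {..<N}" "card R = k"
        and thin: "\<forall>i\<in>R. \<forall>j\<in>R. i \<noteq> j \<longrightarrow> thin G q c1 (V i) (V j)"
      have "f' c * M \<le> real (card (V i))" if "i \<in> R" for i
        using le[of M "f' c"] f'1 M V R that by (meson lessThan_iff less_imp_le order_trans subsetD)
      moreover have "thin G q c (V i) (V j)" if "i \<in> R" "j \<in> R" "i \<noteq> j" for i j
        by (rule thin_mono[OF _ c1(3)]) (use thin that in simp)
      ultimately show ?thesis
        using R by (intro exI[of _ V] exI[of _ R] exI[of _ q] conjI ballI impI) auto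
    next
      fix R assume R: "R \<subseteq> {..<N}" "card R = ?h"
        and indep: "\<forall>i\<in>R. \<forall>j\<in>R. i \<noteq> j \<longrightarrow> \<not> (\<exists>q. thin G q c1 (V i) (V j))"
      obtain \<phi> where \<phi>: "bij_betw \<phi> (verts H) R"
        using finite_same_card_bij[OF finH finite_subset[OF R(1)]] R(2) by auto
      have \<phi>N: "\<phi> x < N" if "x \<in> verts H" for x using bij_betwE[OF \<phi>] R(1) that by blast
      have disj\<phi>: "disjoint_family_on (V \<circ> \<phi>) (verts H)"
        unfolding disjoint_family_on_def
      proof (intro ballI impI)
        fix x y assume xy: "x \<in> verts H" "y \<in> verts H" "x \<noteq> y"
        then have "\<phi> x \<noteq> \<phi> y" using \<phi> by (meson bij_betw_imp_inj_on inj_onD)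
        then show "(V \<circ> \<phi>) x \<inter> (V \<circ> \<phi>) y = {}"
          using disj \<phi>N xy unfolding disjoint_family_on_def by simp
      qed
      have "\<not> t * (\<Prod>x\<in>verts H. real (card ((V \<circ> \<phi>) x)))
              \<le> real (card (transversal_maps H G (verts H) (V \<circ> \<phi>)))"
      proof
        assume *: "t * (\<Prod>x\<in>verts H. real (card ((V \<circ> \<phi>) x)))
              \<le> real (card (transversal_maps H G (verts H) (V \<circ> \<phi>)))"
        have "f' c * M ^ ?h \<le> t * M ^ ?h" using f't M by (intro mult_right_mono) auto
        also have "M ^ ?h = (\<Prod>x\<in>verts H. M)" by simp
        also have "\<dots> \<le> (\<Prod>x\<in>verts H. real (card ((V \<circ> \<phi>) x)))"
          using V \<phi>N M by (intro prod_mono) auto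
        also note *
        also have "real (card (transversal_maps H G (verts H) (V \<circ> \<phi>))) \<le> real (card (copies H G))"
          using transversal_maps_subset_copies[OF H G _ disj\<phi>] V \<phi>N finite_copies[OF H G]
          by (intro of_nat_mono card_mono) auto
        finally show False using few t by simp
      qed
      then obtain x y where xy: "x \<in> verts H" "y \<in> verts H" "x \<noteq> y"
          and pair: "has_thin_pair G c1 t (V (\<phi> x)) (V (\<phi> y))"
        using embed[rule_format, of c1 "V \<circ> \<phi>" G] c1 finV \<phi>N unfolding t_def by auto
      define i j where "i = \<phi> x" and "j = \<phi> y"
      have ij: "i \<in> R" "j \<in> R" "i \<noteq> j"
        using xy \<phi> unfolding i_def j_def by (auto simp: bij_betw_def inj_on_def)
      then have ijN: "i < N" "j < N" using R by auto
      obtain A B q where A: "A \<subseteq> V i" "t * real (card (V i)) \<le> real (card A)"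
        and B: "B \<subseteq> V j" "t * real (card (V j)) \<le> real (card B)" and AB: "thin G q c1 A B"
        using pair unfolding has_thin_pair_def i_def j_def by blast
      \<comment> \<open>Replacing \<open>V i\<close> and \<open>V j\<close> by the thin pair decides \<open>{i, j}\<close> and undoes no decision.\<close>
      define V' where "V' = V(i := A, j := B)"
      have V'_sub: "V' l \<subseteq> V l" for l
        unfolding V'_def using A(1) B(1) by auto
      have V'_card: "t * real (card (V l)) \<le> real (card (V' l))" for l
        unfolding V'_def using A(2) B(2) le[of "real (card (V l))" t] t by auto
      have "undecided G N (f c) V' \<subseteq> undecided G N (f' c) V"
      proof
        fix e assume "e \<in> undecided G N (f c) V'"
        then obtain u v where e: "e = {u, v}" and uv: "u < N" "v < N" "u \<noteq> v"
          and nt: "\<not> (\<exists>q. thin G q (f c) (V' u) (V' v))"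
          unfolding undecided_def by blast
        have "\<not> thin G q (f' c) (V u) (V v)" for q
        proof
          assume "thin G q (f' c) (V u) (V v)"
          then have "thin G q (t * (t * f c)) (V u) (V v)" using f'tt by (rule thin_mono)
          then have "thin G q (t * f c) (V' u) (V v)"
            using V'_sub V'_card finV uv t fc by (rule_tac thin_subset) auto
          then have "thin G q (t * f c) (V v) (V' u)" by (simp add: thin_sym)
          then have "thin G q (f c) (V' v) (V' u)"
            using V'_sub V'_card finV uv t fc finite_subset[OF V'_sub finV]
            by (rule_tac thin_subset) auto
          then show False using nt by (metis thin_sym)
        qed
        then show "e \<in> undecided G N (f' c) V" unfolding e undecided_iff using uv by blast
      qed
      moreover have "{i, j} \<in> undecided G N (f' c) V"
        unfolding undecided_iff using ij ijN indep thin_mono[OF _ f'c1] by blast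
      moreover have "{i, j} \<notin> undecided G N (f c) V'"
        unfolding undecided_iff V'_def using ij thin_mono[OF AB c1(4)] by auto
      ultimately have "undecided G N (f c) V' \<subset> undecided G N (f' c) V" by blast
      then have und': "card (undecided G N (f c) V') < m"
        using und psubset_card_mono[OF finite_subset[OF undecided_subset_Pow]]
        by (metis finite_Pow_iff finite_lessThan less_Suc_eq_le less_le_trans)
      have V'_M: "\<forall>l<N. V' l \<subseteq> verts G \<and> t * M \<le> real (card (V' l))"
      proof (intro allI impI conjI)
        fix l assume l: "l < N"
        show "V' l \<subseteq> verts G" using V'_sub V l by blast
        have "t * M \<le> t * real (card (V l))" using V l t by simp
        then show "t * M \<le> real (card (V' l))" using V'_card[of l] by linarith
      qed
      have disj': "disjoint_family_on V' {..<N}"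
        using disj V'_sub unfolding disjoint_family_on_def by blast
      have "f' c * M ^ ?h \<le> f c * t ^ ?h * M ^ ?h" using f'th M by (intro mult_right_mono) auto
      then have few': "real (card (copies H G)) < f c * (t * M) ^ ?h"
        using few by (simp add: power_mult_distrib mult_ac)
      have "\<exists>W Q q. Q \<subseteq> {..<N} \<and> card Q = k \<and>
          (\<forall>l\<in>Q. W l \<subseteq> V' l \<and> f c * (t * M) \<le> real (card (W l))) \<and>
          (\<forall>u\<in>Q. \<forall>v\<in>Q. u \<noteq> v \<longrightarrow> thin G q c (W u) (W v))"
        using G c mult_pos_pos[OF t(1) M] V'_M disj' few' und'
        by (intro IH[rule_format, of G c "t * M" V'] conjI)
      then obtain W Q q where W: "Q \<subseteq> {..<N}" "card Q = k"
          "\<And>l. l \<in> Q \<Longrightarrow> W l \<subseteq> V' l \<and> f c * (t * M) \<le> real (card (W l))"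
          "\<forall>u\<in>Q. \<forall>v\<in>Q. u \<noteq> v \<longrightarrow> thin G q c (W u) (W v)"
        by blast
      have "f' c * M \<le> f c * t * M" using f'ft M by (intro mult_right_mono) auto
      then have "W l \<subseteq> V l \<and> f' c * M \<le> real (card (W l))" if "l \<in> Q" for l
        using W(3)[OF that] V'_sub[of l] by (auto simp: mult_ac)
      then show ?thesis
        using W(1,2,4) by (intro exI[of _ W] exI[of _ Q] exI[of _ q] conjI ballI impI) auto
    qed
  qed
qed

section \<open>Splitting the graph into blocks\<close>

lemma disjoint_blocks:
  fixes N :: nat
  assumes "finite X" "1 \<le> N" "N \<le> card X"
  shows "\<exists>V. (\<forall>i<N. V i \<subseteq> X \<and> real (card X) / (2 * real N) \<le> real (card (V i))) \<and>
    disjoint_family_on V {..<N}"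
proof -
  define w where "w = card X div N"
  obtain e where e: "bij_betw e {0..<card X} X" using ex_bij_betw_nat_finite[OF assms(1)] by blast
  have block: "{i * w..<(i + 1) * w} \<subseteq> {0..<card X}" if "i < N" for i
  proof -
    have "(i + 1) * w \<le> N * w" using that by (intro mult_le_mono1) auto
    also have "\<dots> \<le> card X" unfolding w_def by simp
    finally show ?thesis by auto
  qed
  have inj: "inj_on e {0..<card X}" using e by (rule bij_betw_imp_inj_on)
  define V where "V i = e ` {i * w..<(i + 1) * w}" for i
  have "card (V i) = w" if "i < N" for i
    unfolding V_def using card_image[OF inj_on_subset[OF inj block[OF that]]] by simp
  moreover have "real (card X) / (2 * real N) \<le> real w"
  proof -
    have "1 \<le> w" unfolding w_def using assms by (metis One_nat_def Suc_leI div_greater_zero_iff less_eq_Suc_le)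
    have "card X < N * (w + 1)"
      unfolding w_def using assms(2) dividend_less_times_div[of N "card X"] by simp
    also have "\<dots> \<le> N * (2 * w)" using \<open>1 \<le> w\<close> by (intro mult_le_mono2) simp
    finally have "real (card X) \<le> real (N * (2 * w))" by (intro of_nat_mono less_imp_le)
    then show ?thesis using assms(2) by (simp add: field_simps)
  qed
  moreover have "V i \<subseteq> X" if "i < N" for i
    unfolding V_def using block[OF that] e by (auto simp: bij_betw_def)
  moreover have "disjoint_family_on V {..<N}"
    unfolding disjoint_family_on_def
  proof (intro ballI impI)
    fix i j assume ij: "i \<in> {..<N}" "j \<in> {..<N}" "i \<noteq> j"
    have "{i * w..<(i + 1) * w} \<inter> {j * w..<(j + 1) * w} = {}"
      using ij(3)
    proof (induction i j rule: linorder_wlog)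
      case (le i j)
      then have "(i + 1) * w \<le> j * w" by (intro mult_le_mono1) simp
      then show ?case by auto
    next
      case (sym i j)
      then show ?case by blast
    qed
    then show "V i \<inter> V j = {}"
      unfolding V_def using inj_on_image_Int[OF inj block block] ij by (metis image_empty lessThan_iff)
  qed
  ultimately show ?thesis by (intro exI[of _ V]) auto
qed

theorem mainTheorem4:
  fixes H :: "'a graph" and k :: nat
  assumes "fin_simple_graph H"
  shows "\<exists>(\<epsilon>::real) (s::real) (K::real). \<epsilon> > 0 \<and> s > 0 \<and> K > 0 \<and>
    (\<forall>(G :: 'b graph) (c::real).
       fin_simple_graph G \<and> real (card (verts G)) > K \<and> 0 \<le> c \<and> c \<le> 1 \<and>
       \<not> saturated (\<epsilon> * c powr s) H G \<longrightarrow>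
       (\<exists>A :: nat \<Rightarrow> 'b set.
          (\<forall>i\<in>{1..k}. A i \<subseteq> verts G) \<and> disjoint_family_on A {1..k} \<and>
          ((\<forall>i\<in>{1..k}. \<forall>j\<in>{1..k}. i \<noteq> j \<longrightarrow>
              sparse_pair G c (A i) (A j) \<and>
              xy_pair G (\<epsilon> * c powr s * real (card (verts G)))
                        (\<epsilon> * c powr s * real (card (verts G))) (A i) (A j)) \<or>
           (\<forall>i\<in>{1..k}. \<forall>j\<in>{1..k}. i \<noteq> j \<longrightarrow>
              dense_pair G (1 - c) (A i) (A j) \<and>
              xy_pair G (\<epsilon> * c powr s * real (card (verts G)))
                        (\<epsilon> * c powr s * real (card (verts G))) (A i) (A j)))))"
proof -
  define h where "h = card (verts H)"
  obtain N where N: "N \<ge> 1" and ramsey: "\<And>(G::'b graph) c V.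
    (\<exists>R\<subseteq>{..<N::nat}. card R = card (verts H) \<and>
        (\<forall>i\<in>R. \<forall>j\<in>R. i \<noteq> j \<longrightarrow> \<not> (\<exists>q. thin G q c (V i) (V j)))) \<or>
    (\<exists>R\<subseteq>{..<N}. card R = k \<and> (\<exists>q. \<forall>i\<in>R. \<forall>j\<in>R. i \<noteq> j \<longrightarrow> thin G q c (V i) (V j)))"
    using ramsey_thin[of "card (verts H)" k, where 'b = 'b] by blast
  \<comment> \<open>Undecided pairs are subsets of \<open>{..<N}\<close>, so this bound on their number always holds.\<close>
  from thin_blocks_if_few_copies[OF assms ramsey, of "2 ^ N + 1"]
  obtain f where f: "f \<in> monomials" and blocks: "\<forall>(G::'b graph) V c M.
    fin_simple_graph G \<and> 0 < c \<and> c \<le> 1 \<and> 0 < M \<and>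
    (\<forall>i<N. V i \<subseteq> verts G \<and> M \<le> real (card (V i))) \<and> disjoint_family_on V {..<N} \<and>
    real (card (copies H G)) < f c * M ^ card (verts H) \<and> card (undecided G N (f c) V) < 2 ^ N + 1 \<longrightarrow>
    (\<exists>W R q. R \<subseteq> {..<N} \<and> card R = k \<and> (\<forall>i\<in>R. W i \<subseteq> V i \<and> f c * M \<le> real (card (W i))) \<and>
       (\<forall>i\<in>R. \<forall>j\<in>R. i \<noteq> j \<longrightarrow> thin G q c (W i) (W j)))" ..
  obtain a p where f_eq: "f = (\<lambda>c. a * c ^ p)" and a: "0 < a" "a \<le> 1"
    using f unfolding monomials_def by blast
  \<comment> \<open>Blocks have size at least \<open>n / (2N)\<close>; the power \<open>h + 1\<close> covers both the copies (power \<open>h\<close>)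
      and the sizes (power \<open>1\<close>, even if \<open>h = 0\<close>).\<close>
  define \<epsilon> where "\<epsilon> = a / (2 * real N) ^ (h + 1)"
  \<comment> \<open>One power more than \<open>f\<close> has, so that \<open>s > 0\<close> even if \<open>p = 0\<close>.\<close>
  define s where "s = real (p + 1)"
  have \<epsilon>: "0 < \<epsilon>" unfolding \<epsilon>_def using a N by simp
  show ?thesis
  proof (rule exI[of _ \<epsilon>], rule exI[of _ s], rule exI[of _ "real N"],
      intro conjI allI impI, goal_cases)
    case (4 G c)
    then have G: "fin_simple_graph G" and n: "real N < real (card (verts G))"
      and c: "0 \<le> c" "c \<le> 1" and unsat: "\<not> saturated (\<epsilon> * c powr s) H G" by auto
    \<comment> \<open>Since \<open>0 powr s = 0\<close>, every graph is saturated when \<open>c = 0\<close>.\<close>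
    have "c \<noteq> 0" using unsat unfolding saturated_def by auto
    then have c0: "0 < c" using c by simp
    define n where "n = real (card (verts G))"
    define M where "M = n / (2 * real N)"
    have "0 < n" using \<open>real N < _\<close> unfolding n_def by simp
    have "0 < M" unfolding M_def using \<open>0 < n\<close> N by simp
    have finG: "finite (verts G)" using G unfolding fin_simple_graph_def by simp
    have cs: "c powr s \<le> c ^ p"
      using c0 c unfolding s_def by (simp only: powr_realpow) (simp add: mult_left_le_one_le)
    have small: "\<epsilon> * c powr s * n ^ l \<le> f c * M ^ l" if "l \<le> h + 1" for l
    proof -
      have "(2 * real N) ^ l \<le> (2 * real N) ^ (h + 1)" using N that by (intro power_increasing) auto
      then have "\<epsilon> \<le> a / (2 * real N) ^ l"
        unfolding \<epsilon>_def using a N by (intro divide_left_mono) auto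
      then have "\<epsilon> * c powr s \<le> a / (2 * real N) ^ l * c ^ p"
        using cs a N by (intro mult_mono) auto
      then have "\<epsilon> * c powr s * n ^ l \<le> a / (2 * real N) ^ l * c ^ p * n ^ l"
        using \<open>0 < n\<close> by (intro mult_right_mono) auto
      then show ?thesis unfolding f_eq M_def by (simp add: power_divide)
    qed
    have "real (card (copies H G)) < \<epsilon> * c powr s * n ^ h"
      using unsat unfolding saturated_def n_def h_def by simp
    then have few: "real (card (copies H G)) < f c * M ^ h" using small[of h] by simp
    obtain V where V: "\<forall>i<N. V i \<subseteq> verts G \<and> M \<le> real (card (V i))" "disjoint_family_on V {..<N}"
      using disjoint_blocks[OF finG N] n unfolding M_def n_def by auto
    have "card (undecided G N (f c) V) < 2 ^ N + 1"
      using card_mono[OF _ undecided_subset_Pow[of G N "f c" V]] by (simp add: card_Pow)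
    then have "\<exists>W R q. R \<subseteq> {..<N} \<and> card R = k \<and>
        (\<forall>i\<in>R. W i \<subseteq> V i \<and> f c * M \<le> real (card (W i))) \<and>
        (\<forall>i\<in>R. \<forall>j\<in>R. i \<noteq> j \<longrightarrow> thin G q c (W i) (W j))"
      using G c0 c(2) \<open>0 < M\<close> V few unfolding h_def
      by (intro blocks[rule_format, of G c M V] conjI)
    then obtain W R q where R: "R \<subseteq> {..<N}" "card R = k"
      and W: "\<And>i. i \<in> R \<Longrightarrow> W i \<subseteq> V i \<and> f c * M \<le> real (card (W i))"
      and thin: "\<forall>i\<in>R. \<forall>j\<in>R. i \<noteq> j \<longrightarrow> thin G q c (W i) (W j)"
      by blast
    obtain \<beta> where \<beta>: "bij_betw \<beta> {1..k} R"
      using ex_bij_betw_nat_finite_1[OF finite_subset[OF R(1)]] R(2) by auto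
    define A where "A i = W (\<beta> i)" for i
    have \<beta>R: "\<beta> i \<in> R" "\<beta> i < N" if "i \<in> {1..k}" for i
      using bij_betwE[OF \<beta>] R(1) that by blast+
    have \<beta>_neq: "\<beta> i \<noteq> \<beta> j" if "i \<in> {1..k}" "j \<in> {1..k}" "i \<noteq> j" for i j
      using inj_on_eq_iff[OF bij_betw_imp_inj_on[OF \<beta>] that(1,2)] that(3) by simp
    have A_sub: "A i \<subseteq> verts G" if "i \<in> {1..k}" for i
      using W[OF \<beta>R(1)[OF that]] V(1) \<beta>R(2)[OF that] unfolding A_def by blast
    have A_card: "\<epsilon> * c powr s * n \<le> real (card (A i))" if "i \<in> {1..k}" for i
      using W[OF \<beta>R(1)[OF that]] small[of 1] unfolding A_def by simp
    have A_disj: "A i \<inter> A j = {}" if "i \<in> {1..k}" "j \<in> {1..k}" "i \<noteq> j" for i j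
    proof -
      have "V (\<beta> i) \<inter> V (\<beta> j) = {}"
        using V(2) \<beta>R \<beta>_neq that unfolding disjoint_family_on_def by simp
      then show ?thesis using W[OF \<beta>R(1)] that unfolding A_def by blast
    qed
    have A_fin: "finite (A i)" if "i \<in> {1..k}" for i using finite_subset[OF A_sub[OF that] finG] .
    have A_thin: "thin G q c (A i) (A j)" if "i \<in> {1..k}" "j \<in> {1..k}" "i \<noteq> j" for i j
      using thin \<beta>R \<beta>_neq that unfolding A_def by blast
    have A_xy: "xy_pair G (\<epsilon> * c powr s * n) (\<epsilon> * c powr s * n) (A i) (A j)"
      if "i \<in> {1..k}" "j \<in> {1..k}" "i \<noteq> j" for i j
      unfolding xy_pair_def using that by (simp add: A_sub A_card A_disj)
    have "disjoint_family_on A {1..k}" unfolding disjoint_family_on_def using A_disj by blast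
    moreover have
      "(\<forall>i\<in>{1..k}. \<forall>j\<in>{1..k}. i \<noteq> j \<longrightarrow> sparse_pair G c (A i) (A j) \<and>
          xy_pair G (\<epsilon> * c powr s * n) (\<epsilon> * c powr s * n) (A i) (A j)) \<or>
       (\<forall>i\<in>{1..k}. \<forall>j\<in>{1..k}. i \<noteq> j \<longrightarrow> dense_pair G (1 - c) (A i) (A j) \<and>
          xy_pair G (\<epsilon> * c powr s * n) (\<epsilon> * c powr s * n) (A i) (A j))"
    proof (cases q)
      case True
      then have "sparse_pair G c (A i) (A j)" if "i \<in> {1..k}" "j \<in> {1..k}" "i \<noteq> j" for i j
        using thin_True_sparse[OF A_disj] A_thin that by simp
      then show ?thesis using A_xy by simp
    next
      case False
      then have "dense_pair G (1 - c) (A i) (A j)" if "i \<in> {1..k}" "j \<in> {1..k}" "i \<noteq> j" for i j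
        using thin_False_dense[OF A_disj] A_thin A_fin that by simp
      then show ?thesis using A_xy by simp
    qed
    ultimately show ?case unfolding n_def using A_sub by (intro exI[of _ A] conjI ballI)
  qed (use \<epsilon> N in \<open>auto simp: s_def\<close>)
qed

end
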